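(* Let $n$, $d$ and $k$ be positive integers such that $d\ge 3$ (and $d\le n/2$). If $C$ is an identifying code in $C_n(1,d-1,d)$ with $k$ codewords, then there exists an identifying code in the infinite triangular grid $\mathcal{T}$ with density $k/n$. Analogously, a locating-dominating (respectively self-identifying) code in $C_n(1,d-1,d)$ with $k$ codewords yields a locating-dominating (respectively self-identifying) code in $\mathcal{T}$ with density $k/n$.
   Context: All graphs are simple and undirected. For a graph $G=(V,E)$ and $u\in V$, $N[u]=\{u\}\cup\{v: uv\in E\}$. A code is a nonempty $C\subseteq V$, and $I(C;u)=N[u]\cap C$. $C$ is dominating if $I(C;u)\neq\emptyset$ for all $u$; identifying if dominating and $I(C;u)\neq I(C;v)$ for all distinct $u,v\in V$; locating-dominating if dominating and $I(C;u)\neq I(C;v)$ for all distinct $u,v\in V\setminus C$; self-identifying if $I(C;u)\setminus I(C;v)\neq\emptyset$ for all distinct $u,v\in V$. For positive integers $n$ and $d_1,\dots,d_k\le n/2$, the circulant graph $C_n(d_1,\dots,d_k)$ has vertex set $\mathbb{Z}_n$, and the open neighbourhood of $u$ is $\{u\pm d_1,\dots,u\pm d_k\}$ modulo $n$. The infinite triangular grid $\mathcal{T}$ has vertex set $\mathbb{Z}^2$ and $N[(x,y)]=\{(x',y'): |x-x'|+|y-y'|\le1\}\cup\{(x+1,y+1),(x-1,y-1)\}$. With $Q_m=\{(x,y)\in\mathbb{Z}^2:|x|\le m,|y|\le m\}$, the density of $C\subseteq\mathbb{Z}^2$ is $\limsup_{m\to\infty}|C\cap Q_m|/|Q_m|$.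 *)

theory Defs
  imports Complex_Main "HOL-Library.Extended_Real"
begin

record 'a ugraph =
  verts :: "'a set"
  edges :: "'a set set"

definition simple_graph :: "'a ugraph \<Rightarrow> bool" where
  "simple_graph G \<longleftrightarrow> (\<forall>e\<in>edges G. e \<subseteq> verts G \<and> card e = 2)"

definition open_nbhd :: "'a ugraph \<Rightarrow> 'a \<Rightarrow> 'a set" where
  "open_nbhd G u = {v. {u, v} \<in> edges G}"

definition closed_nbhd :: "'a ugraph \<Rightarrow> 'a \<Rightarrow> 'a set" where
  "closed_nbhd G u = {u} \<union> open_nbhd G u"

definition code :: "'a ugraph \<Rightarrow> 'a set \<Rightarrow> bool" where
  "code G C \<longleftrightarrow> C \<noteq> {} \<and> C \<subseteq> verts G"

definition I_set :: "'a ugraph \<Rightarrow> 'a set \<Rightarrow> 'a \<Rightarrow> 'a set" where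
  "I_set G C u = closed_nbhd G u \<inter> C"

definition dominating_code :: "'a ugraph \<Rightarrow> 'a set \<Rightarrow> bool" where
  "dominating_code G C \<longleftrightarrow> code G C \<and> (\<forall>u\<in>verts G. I_set G C u \<noteq> {})"

definition identifying_code :: "'a ugraph \<Rightarrow> 'a set \<Rightarrow> bool" where
  "identifying_code G C \<longleftrightarrow> dominating_code G C \<and>
     (\<forall>u\<in>verts G. \<forall>v\<in>verts G. u \<noteq> v \<longrightarrow> I_set G C u \<noteq> I_set G C v)"

definition locating_dominating_code :: "'a ugraph \<Rightarrow> 'a set \<Rightarrow> bool" where
  "locating_dominating_code G C \<longleftrightarrow> dominating_code G C \<and>
     (\<forall>u\<in>verts G - C. \<forall>v\<in>verts G - C. u \<noteq> v \<longrightarrow> I_set G C u \<noteq> I_set G C v)"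

definition self_identifying_code :: "'a ugraph \<Rightarrow> 'a set \<Rightarrow> bool" where
  "self_identifying_code G C \<longleftrightarrow> code G C \<and>
     (\<forall>u\<in>verts G. \<forall>v\<in>verts G. u \<noteq> v \<longrightarrow> I_set G C u - I_set G C v \<noteq> {})"

text \<open>
  The group of integers modulo \<open>n\<close> is represented by the residues \<open>0, \<dots>, n - 1\<close>.  The
  definition of the circulant graph is meant for sets \<open>D\<close> of positive integers that are
  at most \<open>n / 2\<close>: it is then a simple graph (\<open>simple_graph_circulant\<close>) with the intended
  open neighbourhoods (\<open>open_nbhd_circulant\<close>).
\<close>

definition circulant_graph :: "nat \<Rightarrow> nat set \<Rightarrow> int ugraph" where
  "circulant_graph n D =
     \<lparr> verts = {0..<int n},
       edges = {{u, v} | u v. u \<in> {0..<int n} \<and>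
         (\<exists>d\<in>D. v = (u + int d) mod int n \<or> v = (u - int d) mod int n)} \<rparr>"

lemma circulant_shift_neq:
  assumes "0 < d" "2 * d \<le> n" "0 \<le> u" "u < int n"
  shows "(u + int d) mod int n \<noteq> u" "(u - int d) mod int n \<noteq> u"
proof -
  have nd: "\<not> int n dvd int d"
    using assms zdvd_imp_le[of "int n" "int d"] by auto
  have u: "u = u mod int n"
    using assms by simp
  show "(u + int d) mod int n \<noteq> u"
  proof
    assume "(u + int d) mod int n = u"
    then have "(u + int d) mod int n = u mod int n" using u by simp
    then have "int n dvd (u + int d) - u" by (simp only: mod_eq_dvd_iff)
    then show False using nd by simp
  qed
  show "(u - int d) mod int n \<noteq> u"
  proof
    assume "(u - int d) mod int n = u"
    then have "(u - int d) mod int n = u mod int n" using u by simp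
    then have "int n dvd (u - int d) - u" by (simp only: mod_eq_dvd_iff)
    then show False using nd by simp
  qed
qed

lemma simple_graph_circulant:
  assumes "\<forall>d\<in>D. 0 < d \<and> 2 * d \<le> n"
  shows "simple_graph (circulant_graph n D)"
proof -
  have "{u, v} \<subseteq> {0..<int n} \<and> card {u, v} = 2"
    if u: "u \<in> {0..<int n}" and d: "d \<in> D"
      and v: "v = (u + int d) mod int n \<or> v = (u - int d) mod int n" for u v d
  proof -
    have "v \<noteq> u"
      using circulant_shift_neq[of d n u] assms u d v by auto
    moreover have "v \<in> {0..<int n}"
      using u v by auto
    ultimately show ?thesis using u by auto
  qed
  then show ?thesis
    unfolding simple_graph_def circulant_graph_def ugraph.simps by blast
qed

lemma open_nbhd_circulant:
  assumes "u \<in> {0..<int n}"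
  shows "open_nbhd (circulant_graph n D) u =
    (\<Union>d\<in>D. {(u + int d) mod int n, (u - int d) mod int n})"
proof -
  have 1: "u = (v - int d) mod int n" if "v = (u + int d) mod int n" for v d
    using assms that by (simp add: mod_simps)
  have 2: "u = (v + int d) mod int n" if "v = (u - int d) mod int n" for v d
    using assms that by (simp add: mod_simps)
  have 3: "v = (u + int d) mod int n"
    if "u = (v - int d) mod int n" "v \<in> {0..<int n}" for v d
    using that by (simp add: mod_simps)
  have 4: "v = (u - int d) mod int n"
    if "u = (v + int d) mod int n" "v \<in> {0..<int n}" for v d
    using that by (simp add: mod_simps)
  show ?thesis
  proof (intro set_eqI iffI)
    fix w assume "w \<in> open_nbhd (circulant_graph n D) u"
    then obtain a b d where ab: "{u, w} = {a, b}" "a \<in> {0..<int n}" "d \<in> D"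
        "b = (a + int d) mod int n \<or> b = (a - int d) mod int n"
      by (auto simp: open_nbhd_def circulant_graph_def)
    then consider "u = a" "w = b" | "u = b" "w = a"
      by (auto simp: doubleton_eq_iff)
    then have "w = (u + int d) mod int n \<or> w = (u - int d) mod int n"
    proof cases
      case 1 then show ?thesis using ab by blast
    next
      case 2 then show ?thesis using ab 3[of w d] 4[of w d] by blast
    qed
    then show "w \<in> (\<Union>d\<in>D. {(u + int d) mod int n, (u - int d) mod int n})"
      using ab by blast
  next
    fix w assume "w \<in> (\<Union>d\<in>D. {(u + int d) mod int n, (u - int d) mod int n})"
    then show "w \<in> open_nbhd (circulant_graph n D) u"
      using assms unfolding open_nbhd_def circulant_graph_def by auto
  qed
qed

definition triangular_ball :: "int \<times> int \<Rightarrow> (int \<times> int) set" where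
  "triangular_ball = (\<lambda>(x, y).
     {(x', y'). \<bar>x - x'\<bar> + \<bar>y - y'\<bar> \<le> 1} \<union> {(x + 1, y + 1), (x - 1, y - 1)})"

definition triangular_grid :: "(int \<times> int) ugraph" where
  "triangular_grid =
     \<lparr> verts = UNIV, edges = {{p, q} | p q. p \<noteq> q \<and> q \<in> triangular_ball p} \<rparr>"

lemma triangular_ball_sym: "q \<in> triangular_ball p \<longleftrightarrow> p \<in> triangular_ball q"
proof -
  obtain x y x' y' where pq: "p = (x, y)" "q = (x', y')"
    by (cases p, cases q) blast
  have "\<bar>x - x'\<bar> = \<bar>x' - x\<bar>" "\<bar>y - y'\<bar> = \<bar>y' - y\<bar>"
    by (simp_all only: abs_minus_commute)
  moreover have "x' = x + 1 \<longleftrightarrow> x = x' - 1" "y' = y + 1 \<longleftrightarrow> y = y' - 1"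
      "x' = x - 1 \<longleftrightarrow> x = x' + 1" "y' = y - 1 \<longleftrightarrow> y = y' + 1"
    by linarith+
  ultimately show ?thesis
    unfolding pq triangular_ball_def prod.case Un_iff mem_Collect_eq insert_iff empty_iff
      prod.inject by metis
qed

lemma simple_graph_triangular_grid: "simple_graph triangular_grid"
  by (auto simp: simple_graph_def triangular_grid_def)

lemma closed_nbhd_triangular_grid: "closed_nbhd triangular_grid p = triangular_ball p"
proof -
  have "p \<in> triangular_ball p"
    by (cases p) (simp add: triangular_ball_def)
  moreover have "{p, q} \<in> edges triangular_grid \<longleftrightarrow> p \<noteq> q \<and> q \<in> triangular_ball p" for q
    unfolding triangular_grid_def ugraph.simps mem_Collect_eq doubleton_eq_iff
    using triangular_ball_sym by blast
  ultimately show ?thesis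
    unfolding closed_nbhd_def open_nbhd_def by blast
qed

definition Q_box :: "nat \<Rightarrow> (int \<times> int) set" where
  "Q_box m = {(x, y). \<bar>x\<bar> \<le> int m \<and> \<bar>y\<bar> \<le> int m}"

text \<open>The density is taken in \<^typ>\<open>ereal\<close>, where every limit superior exists.\<close>

definition grid_density :: "(int \<times> int) set \<Rightarrow> ereal" where
  "grid_density C =
     limsup (\<lambda>m. ereal (real (card (C \<inter> Q_box m)) / real (card (Q_box m))))"

end

theory Submission
  imports Defs
begin

text \<open>
  The map \<open>(x, y) \<mapsto> x + (d - 1) y mod n\<close> is a homomorphism from \<open>\<int>\<^sup>2\<close> onto \<open>\<int>\<^sub>n\<close> sending the
  six steps of the triangular grid to \<open>\<plusminus>1\<close>, \<open>\<plusminus>(d - 1)\<close>, \<open>\<plusminus>d\<close>, so it maps closed neighbourhoods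
  onto closed neighbourhoods, and the preimage of a code separates any two points with different
  images as well as the code does. Two distinct points \<open>p\<close>, \<open>q\<close> of one fibre have disjoint closed
  neighbourhoods, unless \<open>n = 2d\<close> and \<open>q = p \<plusminus> (2, 2)\<close>. In that case the only common neighbour is
  \<open>p \<plusminus> (1, 1)\<close>, and it lies in the same fibre as \<open>p \<mp> (1, 1)\<close>, so that a codeword covering both
  \<open>p\<close> and \<open>q\<close> comes with one that covers \<open>p\<close> only. The density is that of the code because every
  row of the preimage is \<open>n\<close>-periodic.
\<close>

section \<open>Counting residues in intervals\<close>

lemma card_residues_period:
  fixes a :: int
  assumes "C \<subseteq> {0..<int n}" "0 < n"
  shows "card {x \<in> {a..<a + int n}. x mod int n \<in> C} = card C"
proof (rule bij_betw_same_card)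
  show "bij_betw (\<lambda>x. x mod int n) {x \<in> {a..<a + int n}. x mod int n \<in> C} C"
  \<comment> \<open>\<open>a + (c - a) mod int n\<close> is the one representative of the class of
    \<open>c\<close> in the window of length \<open>n\<close> starting at \<open>a\<close>.\<close>
  proof (rule bij_betw_byWitness[where f' = "\<lambda>c. a + (c - a) mod int n"])
    show "\<forall>x\<in>{x \<in> {a..<a + int n}. x mod int n \<in> C}. a + (x mod int n - a) mod int n = x"
      by (simp add: mod_simps)
    show "\<forall>c\<in>C. (a + (c - a) mod int n) mod int n = c"
      using assms by (auto simp: mod_simps)
    show "(\<lambda>x. x mod int n) ` {x \<in> {a..<a + int n}. x mod int n \<in> C} \<subseteq> C"
      by auto
    show "(\<lambda>c. a + (c - a) mod int n) ` C \<subseteq> {x \<in> {a..<a + int n}. x mod int n \<in> C}"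
      using assms by (auto simp: mod_simps subset_iff)
  qed
qed

text \<open>Removing a full period lowers both terms by \<open>n * card C\<close>. What remains is
  an interval shorter than \<open>n\<close>, for which both terms lie between 0 and
  \<open>n * n\<close>.\<close>

lemma card_residues_interval:
  fixes a :: int
  assumes C: "C \<subseteq> {0..<int n}" and n: "0 < n"
  shows "\<bar>int n * int (card {x \<in> {a..<a + int N}. x mod int n \<in> C}) - int (card C) * int N\<bar>
    \<le> int n * int n"
proof (induction N arbitrary: a rule: less_induct)
  case (less N)
  let ?S = "\<lambda>a N. {x \<in> {a..<a + int N}. x mod int n \<in> C}"
  show ?case
  proof (cases "N < n")
    case True
    have "card (?S a N) \<le> card {a..<a + int N}"
      by (rule card_mono) auto
    then have s: "int (card (?S a N)) \<le> int n" using True by simp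
    have "card C \<le> card {0..<int n}"
      using C by (intro card_mono) auto
    then have "int (card C) * int N \<le> int n * int n"
      using True by (intro mult_mono) auto
    moreover have "int n * int (card (?S a N)) \<le> int n * int n"
      using s by (intro mult_left_mono) auto
    moreover have "0 \<le> int (card C) * int N" "0 \<le> int n * int (card (?S a N))"
      by simp_all
    ultimately show ?thesis by linarith
  next
    case False
    then obtain M where M: "N = n + M" using le_Suc_ex by (metis not_le)
    have "?S a N = ?S a n \<union> ?S (a + int n) M"
      using M by auto
    moreover have "card (?S a n \<union> ?S (a + int n) M) = card (?S a n) + card (?S (a + int n) M)"
      by (rule card_Un_disjoint) (auto intro!: finite_subset[OF _ finite_atLeastLessThan_int])
    ultimately have "card (?S a N) = card C + card (?S (a + int n) M)"
      using card_residues_period[OF C n] by simp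
    then have "int n * int (card (?S a N)) - int (card C) * int N
        = int n * int (card (?S (a + int n) M)) - int (card C) * int M"
      using M by (simp add: algebra_simps)
    then show ?thesis using less.IH[of M "a + int n"] M n by simp
  qed
qed

section \<open>The covering of the circulant graph by the triangular grid\<close>

lemma triangular_ball_explicit:
  "triangular_ball (x, y) =
    {(x, y), (x + 1, y), (x - 1, y), (x, y + 1), (x, y - 1), (x + 1, y + 1), (x - 1, y - 1)}"
proof -
  have "\<bar>x - x'\<bar> + \<bar>y - y'\<bar> \<le> 1 \<longleftrightarrow> x' = x \<and> y' = y \<or> x' = x + 1 \<and> y' = y \<or> x' = x - 1 \<and> y' = y
      \<or> x' = x \<and> y' = y + 1 \<or> x' = x \<and> y' = y - 1" for x' y'
    by arith
  then show ?thesis unfolding triangular_ball_def by auto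
qed

lemma verts_circulant_graph: "verts (circulant_graph n D) = {0..<int n}"
  by (simp add: circulant_graph_def)

lemma verts_triangular_grid: "verts triangular_grid = UNIV"
  by (simp add: triangular_grid_def)

lemma Q_box_eq: "Q_box m = {- int m..int m} \<times> {- int m..int m}"
  by (auto simp: Q_box_def)

lemma card_Q_box: "card (Q_box m) = (2 * m + 1) * (2 * m + 1)"
  by (simp add: Q_box_eq card_cartesian_product nat_add_distrib nat_mult_distrib)

locale circulant_cover =
  fixes n d :: nat
  assumes d_ge_3: "3 \<le> d" and double_d_le_n: "2 * d \<le> n"
begin

abbreviation G :: "int ugraph" where
  "G \<equiv> circulant_graph n {1, d - 1, d}"

definition proj :: "int \<times> int \<Rightarrow> int" where
  "proj = (\<lambda>(x, y). (x + (int d - 1) * y) mod int n)"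

lemma n_pos: "0 < n"
  using d_ge_3 double_d_le_n by simp

lemma proj_in_verts: "proj p \<in> verts G"
  using n_pos by (cases p) (simp add: proj_def verts_circulant_graph)

lemma proj_surj: "u \<in> verts G \<Longrightarrow> proj (u, 0) = u"
  by (simp add: proj_def verts_circulant_graph)

lemma closed_nbhd_proj: "closed_nbhd G (proj p) = proj ` closed_nbhd triangular_grid p"
proof -
  obtain x y where p: "p = (x, y)" by (cases p)
  have d: "int (d - Suc 0) = int d - 1" using d_ge_3 by simp
  have "proj p \<in> {0..<int n}" using proj_in_verts verts_circulant_graph by simp
  then show ?thesis
    unfolding closed_nbhd_triangular_grid unfolding p triangular_ball_explicit closed_nbhd_def
    by (subst open_nbhd_circulant) (auto simp: proj_def d mod_simps algebra_simps)
qed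

text \<open>Images preserve equality and inclusion of sets, so whatever separates
  \<open>proj p\<close> from \<open>proj q\<close> in the circulant graph also separates
  \<open>p\<close> from \<open>q\<close> in the grid.\<close>

lemma I_set_proj: "I_set G C (proj p) = proj ` I_set triangular_grid (proj -` C) p"
  unfolding I_set_def closed_nbhd_proj by auto

text \<open>The displacement between the two points is a difference of two moves, each zero or a
  step of the grid. Its unreduced image \<open>e\<close> is a multiple of \<open>n\<close> with
  \<open>|e|\<close> \<le> \<open>2 * d\<close> \<le> \<open>n\<close>, which leaves only 0 and
  \<open>n\<close> up to sign.\<close>

lemma fibre_common_neighbour:
  assumes "proj (x, y) = proj (x', y')" and ne: "(x, y) \<noteq> (x', y')"
    and c: "c \<in> triangular_ball (x, y)" and c': "c \<in> triangular_ball (x', y')"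
  obtains s :: int where "\<bar>s\<bar> = 1" "n = 2 * d" "c = (x + s, y + s)" "x' = x + 2 * s" "y' = y + 2 * s"
proof -
  define e where "e = (x' - x) + (int d - 1) * (y' - y)"
  have "int n dvd (x' + (int d - 1) * y') - (x + (int d - 1) * y)"
    using assms(1) by (simp add: proj_def mod_eq_dvd_iff dvd_diff_commute)
  then have "int n dvd e" by (simp add: e_def algebra_simps)
  then have large: "e \<noteq> 0 \<Longrightarrow> int n \<le> \<bar>e\<bar>"
    using dvd_imp_le_int[of e "int n"] by simp
  obtain a b where ab: "c = (x + a, y + b)"
      "(a, b) \<in> {(0,0),(1,0),(-1,0),(0,1),(0,-1),(1,1),(-1,-1)}"
    using c unfolding triangular_ball_explicit by fastforce
  obtain a' b' where ab': "c = (x' + a', y' + b')"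
      "(a', b') \<in> {(0,0),(1,0),(-1,0),(0,1),(0,-1),(1,1),(-1,-1)}"
    using c' unfolding triangular_ball_explicit by fastforce
  have x': "x' = x + a - a'" "y' = y + b - b'" using ab ab' by auto
  have e: "e = (a - a') + (int d - 1) * (b - b')" by (simp add: e_def x')
  have d: "3 \<le> int d" "2 * int d \<le> int n" using d_ge_3 double_d_le_n by simp_all
  \<comment> \<open>When \<open>a - a'\<close> and \<open>b - b'\<close> have opposite signs, both
    have absolute value 1, so \<open>e = 0\<close> for distinct points would force
    \<open>d = 2\<close>. The value \<open>|e| = 2 * d\<close> arises only from the two opposite
    diagonal steps.\<close>
  have "\<bar>a\<bar> = 1 \<and> a = b \<and> a' = - a \<and> b' = - a \<and> int n = 2 * int d"
    using ab(2) ab'(2) ne large d unfolding e x' by auto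
  then show thesis
    using that[of a] ab x' by auto
qed

text \<open>Self-identification asks for non-inclusion rather than inequality. An empty I-set would
  be included in every other one, hence the assumption \<open>dom\<close>.\<close>

lemma fibre_separated:
  assumes eq: "proj p = proj q" and ne: "p \<noteq> q"
    and dom: "I_set triangular_grid (proj -` C) p \<noteq> {}"
  shows "\<not> I_set triangular_grid (proj -` C) p \<subseteq> I_set triangular_grid (proj -` C) q"
proof
  assume sub: "I_set triangular_grid (proj -` C) p \<subseteq> I_set triangular_grid (proj -` C) q"
  obtain x y x' y' where pq: "p = (x, y)" "q = (x', y')" by (cases p, cases q)
  obtain c where c: "c \<in> triangular_ball p" "c \<in> triangular_ball q" "proj c \<in> C"
    using dom sub by (auto simp: I_set_def closed_nbhd_triangular_grid)
  obtain s :: int where s: "\<bar>s\<bar> = 1" "n = 2 * d" "c = (x + s, y + s)"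
      "x' = x + 2 * s" "y' = y + 2 * s"
    using fibre_common_neighbour[of x y x' y' c] eq ne c pq by auto
  \<comment> \<open>This is the neighbour of \<open>p\<close> opposite to \<open>c\<close>. Their
    displacement \<open>(2 * s, 2 * s)\<close> has unreduced image
    \<open>2 * d * s = n * s\<close>.\<close>
  have "proj c = proj (x - s, y - s)"
  proof -
    have "(x + s + (int d - 1) * (y + s)) - (x - s + (int d - 1) * (y - s)) = int n * s"
      using s(2) by (simp add: algebra_simps)
    then show ?thesis using s(3) by (simp add: proj_def mod_eq_dvd_iff)
  qed
  moreover have "(x - s, y - s) \<in> triangular_ball p"
    using s(1) unfolding pq triangular_ball_explicit by auto
  ultimately have "(x - s, y - s) \<in> triangular_ball q"
    using sub c(3) by (auto simp: I_set_def closed_nbhd_triangular_grid)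
  \<comment> \<open>Seen from \<open>q\<close>, the point is displaced by
    \<open>(- 3 * s, - 3 * s)\<close>, which is no step of the grid.\<close>
  then show False
    using s(1) unfolding pq s(4,5) triangular_ball_explicit by simp presburger
qed

section \<open>Lifting codes to the grid\<close>

lemma dominating_code_vimage:
  assumes "dominating_code G C"
  shows "dominating_code triangular_grid (proj -` C)"
proof -
  have "C \<noteq> {}" "C \<subseteq> verts G" using assms by (auto simp: dominating_code_def code_def)
  then have "proj -` C \<noteq> {}" using proj_surj by fastforce
  moreover have "I_set triangular_grid (proj -` C) p \<noteq> {}" for p
    using assms proj_in_verts[of p] I_set_proj[of C p] by (auto simp: dominating_code_def)
  ultimately show ?thesis
    by (simp add: dominating_code_def code_def verts_triangular_grid)
qed

lemma fibre_distinct_I_sets: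
  assumes "dominating_code G C" "proj p = proj q" "p \<noteq> q"
  shows "I_set triangular_grid (proj -` C) p \<noteq> I_set triangular_grid (proj -` C) q"
  using fibre_separated[OF assms(2,3), of C] dominating_code_vimage[OF assms(1)]
  unfolding dominating_code_def verts_triangular_grid by blast

lemma identifying_code_vimage:
  assumes "identifying_code G C"
  shows "identifying_code triangular_grid (proj -` C)"
proof -
  have dom: "dominating_code G C" using assms by (simp add: identifying_code_def)
  have "I_set triangular_grid (proj -` C) p \<noteq> I_set triangular_grid (proj -` C) q" if "p \<noteq> q" for p q
  proof (cases "proj p = proj q")
    case True
    then show ?thesis using fibre_distinct_I_sets[OF dom] that by blast
  next
    case False
    then have "I_set G C (proj p) \<noteq> I_set G C (proj q)"
      using assms proj_in_verts by (auto simp: identifying_code_def)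
    then show ?thesis unfolding I_set_proj by metis
  qed
  then show ?thesis
    using dominating_code_vimage[OF dom] by (simp add: identifying_code_def)
qed

lemma locating_dominating_code_vimage:
  assumes "locating_dominating_code G C"
  shows "locating_dominating_code triangular_grid (proj -` C)"
proof -
  have dom: "dominating_code G C" using assms by (simp add: locating_dominating_code_def)
  have "I_set triangular_grid (proj -` C) p \<noteq> I_set triangular_grid (proj -` C) q"
    if "p \<noteq> q" "proj p \<notin> C" "proj q \<notin> C" for p q
  proof (cases "proj p = proj q")
    case True
    then show ?thesis using fibre_distinct_I_sets[OF dom] that by blast
  next
    case False
    then have "I_set G C (proj p) \<noteq> I_set G C (proj q)"
      using assms proj_in_verts that by (auto simp: locating_dominating_code_def)
    then show ?thesis unfolding I_set_proj by metis
  qed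
  then show ?thesis
    using dominating_code_vimage[OF dom] by (simp add: locating_dominating_code_def)
qed

text \<open>Domination is implicit in self-identification: an empty I-set minus that of another
  vertex would be empty.\<close>

lemma self_identifying_code_dominating:
  assumes "self_identifying_code G C"
  shows "dominating_code G C"
proof -
  have "I_set G C u \<noteq> {}" if u: "u \<in> verts G" for u
  proof -
    \<comment> \<open>Any second vertex would do; 0 and 1 are both vertices because \<open>n\<close>
      \<ge> 6.\<close>
    define v :: int where "v = (if u = 0 then 1 else 0)"
    have "v \<in> verts G" "u \<noteq> v"
      using d_ge_3 double_d_le_n by (auto simp: v_def verts_circulant_graph)
    then show ?thesis using assms u by (auto simp: self_identifying_code_def)
  qed
  then show ?thesis using assms by (auto simp: self_identifying_code_def dominating_code_def)
qed

lemma self_identifying_code_vimage: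
  assumes "self_identifying_code G C"
  shows "self_identifying_code triangular_grid (proj -` C)"
proof -
  have dom: "dominating_code triangular_grid (proj -` C)"
    using assms by (intro dominating_code_vimage self_identifying_code_dominating)
  have "\<not> I_set triangular_grid (proj -` C) p \<subseteq> I_set triangular_grid (proj -` C) q"
    if "p \<noteq> q" for p q
  proof (cases "proj p = proj q")
    case True
    then show ?thesis
      using fibre_separated that dom unfolding dominating_code_def verts_triangular_grid by blast
  next
    case False
    then have "I_set G C (proj p) - I_set G C (proj q) \<noteq> {}"
      using assms proj_in_verts by (auto simp: self_identifying_code_def)
    then show ?thesis unfolding I_set_proj by blast
  qed
  then show ?thesis
    using dom by (simp add: self_identifying_code_def dominating_code_def)
qed

section \<open>Density of the preimage\<close>

lemma card_vimage_Q_box: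
  assumes C: "C \<subseteq> verts G"
  shows "\<bar>int n * int (card (proj -` C \<inter> Q_box m)) - int (card C) * int ((2 * m + 1) * (2 * m + 1))\<bar>
    \<le> int (2 * m + 1) * (int n * int n)"
proof -
  let ?J = "{- int m..int m}"
  define R where "R y = {x \<in> ?J. (x + (int d - 1) * y) mod int n \<in> C}" for y
  have J: "card ?J = 2 * m + 1" by simp
  \<comment> \<open>\<open>SIGMA\<close> puts the row index \<open>y\<close> first, hence the swap
    of coordinates.\<close>
  have "proj -` C \<inter> Q_box m = prod.swap ` (SIGMA y:?J. R y)"
    by (force simp: Q_box_eq proj_def R_def)
  then have "card (proj -` C \<inter> Q_box m) = card (SIGMA y:?J. R y)"
    by (simp add: card_image)
  also have "\<dots> = (\<Sum>y\<in>?J. card (R y))"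
    by (rule card_SigmaI) (auto simp: R_def intro!: finite_subset[OF _ finite_atLeastAtMost_int])
  finally have card: "card (proj -` C \<inter> Q_box m) = (\<Sum>y\<in>?J. card (R y))" .
  have row: "\<bar>int n * int (card (R y)) - int (card C) * int (2 * m + 1)\<bar> \<le> int n * int n" for y
  proof -
    define a where "a = (int d - 1) * y"
    \<comment> \<open>Translation by \<open>a\<close> turns the condition on row \<open>y\<close>
      into a plain residue condition on an interval of length \<open>2 * m + 1\<close>.\<close>
    have "bij_betw (\<lambda>x. x + a) (R y)
        {x \<in> {a - int m..<a - int m + int (2 * m + 1)}. x mod int n \<in> C}"
      by (rule bij_betw_byWitness[where f' = "\<lambda>x. x - a"]) (auto simp: R_def a_def)
    from bij_betw_same_card[OF this] show ?thesis
      using card_residues_interval[of C n "a - int m" "2 * m + 1"] C n_pos verts_circulant_graph by simp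
  qed
  have "int n * int (card (proj -` C \<inter> Q_box m)) - int (card C) * int ((2 * m + 1) * (2 * m + 1))
      = (\<Sum>y\<in>?J. int n * int (card (R y)) - int (card C) * int (2 * m + 1))"
    unfolding card by (simp add: sum_subtractf sum_distrib_left algebra_simps)
  \<comment> \<open>Each row errs by at most \<open>n * n\<close>, so the total error is linear in
    \<open>m\<close>, against a box of quadratic size.\<close>
  also have "\<bar>\<dots>\<bar> \<le> (\<Sum>y\<in>?J. \<bar>int n * int (card (R y)) - int (card C) * int (2 * m + 1)\<bar>)"
    by (rule sum_abs)
  also have "\<dots> \<le> (\<Sum>y\<in>?J. int n * int n)"
    by (intro sum_mono row)
  also have "\<dots> = int (2 * m + 1) * (int n * int n)"
    by (simp only: sum_constant J of_nat_id)
  finally show ?thesis .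
qed

lemma grid_density_vimage:
  assumes C: "C \<subseteq> verts G"
  shows "grid_density (proj -` C) = ereal (real (card C) / real n)"
proof -
  define f where "f m = real (card (proj -` C \<inter> Q_box m)) / real (card (Q_box m))" for m
  \<comment> \<open>The error is at most \<open>n / (2 * m + 1)\<close>, relaxed to
    \<open>n / (m + 1)\<close> to match a standard null sequence. The quotients thus converge, and
    the limit superior is their limit.\<close>
  have bound: "\<bar>f m - real (card C) / real n\<bar> \<le> real n * inverse (real (Suc m))" for m
  proof -
    define A where "A = real (card (proj -` C \<inter> Q_box m))"
    define M where "M = real (2 * m + 1)"
    have M: "M > 0" "real (Suc m) \<le> M" by (simp_all add: M_def)
    have n: "real n > 0" using n_pos by simp
    have "\<bar>real n * A - real (card C) * (M * M)\<bar> \<le> M * (real n * real n)"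
    proof -
      have "real_of_int \<bar>int n * int (card (proj -` C \<inter> Q_box m)) -
            int (card C) * int ((2 * m + 1) * (2 * m + 1))\<bar>
          \<le> real_of_int (int (2 * m + 1) * (int n * int n))"
        using card_vimage_Q_box[OF C] by (simp only: of_int_le_iff)
      then show ?thesis by (simp add: A_def M_def algebra_simps)
    qed
    moreover have "f m - real (card C) / real n
        = (real n * A - real (card C) * (M * M)) / (real n * (M * M))"
    proof -
      have "f m = A / (M * M)"
        unfolding f_def A_def M_def card_Q_box by (simp only: of_nat_mult)
      then show ?thesis using M n by (simp add: field_simps)
    qed
    ultimately have "\<bar>f m - real (card C) / real n\<bar> \<le> M * (real n * real n) / \<bar>real n * (M * M)\<bar>"
      by (simp only: abs_divide divide_right_mono abs_ge_zero)
    also have "\<dots> = real n / M" using M n by (simp add: field_simps)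
    also have "\<dots> \<le> real n * inverse (real (Suc m))"
      using M n by (simp add: field_simps del: of_nat_Suc)
    finally show ?thesis .
  qed
  have "(\<lambda>m. f m - real (card C) / real n) \<longlonglongrightarrow> 0"
    by (rule tendsto_0_le[OF LIMSEQ_inverse_real_of_nat, where K = "real n"])
      (use bound in \<open>simp add: mult.commute del: of_nat_Suc\<close>)
  then have "f \<longlonglongrightarrow> real (card C) / real n"
    by (simp add: LIM_zero_iff)
  then have "(\<lambda>m. ereal (f m)) \<longlonglongrightarrow> ereal (real (card C) / real n)"
    by (rule tendsto_ereal)
  then show ?thesis
    unfolding grid_density_def f_def by (rule lim_imp_Limsup[rotated]) simp
qed

end

theorem theorem2:
  fixes n d k :: nat
  assumes "0 < n" and "0 < k" and "3 \<le> d" and "real d \<le> real n / 2"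
  shows "(\<forall>C. identifying_code (circulant_graph n {1, d - 1, d}) C \<and> card C = k \<longrightarrow>
            (\<exists>C'. identifying_code triangular_grid C' \<and>
                  grid_density C' = ereal (real k / real n))) \<and>
         (\<forall>C. locating_dominating_code (circulant_graph n {1, d - 1, d}) C \<and> card C = k \<longrightarrow>
            (\<exists>C'. locating_dominating_code triangular_grid C' \<and>
                  grid_density C' = ereal (real k / real n))) \<and>
         (\<forall>C. self_identifying_code (circulant_graph n {1, d - 1, d}) C \<and> card C = k \<longrightarrow>
            (\<exists>C'. self_identifying_code triangular_grid C' \<and>
                  grid_density C' = ereal (real k / real n)))"
proof -
  interpret circulant_cover n d
    using assms by unfold_locales auto
  have "C \<subseteq> verts G" if "dominating_code G C" for C
    using that by (simp add: dominating_code_def code_def)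
  \<comment> \<open>All three kinds of code are dominating, so one density statement serves them;
    the witness is always the preimage of \<open>C\<close> under \<open>proj\<close>.\<close>
  then have density: "grid_density (proj -` C) = ereal (real (card C) / real n)"
    if "dominating_code G C" for C
    using that grid_density_vimage by blast
  show ?thesis
    using density identifying_code_vimage locating_dominating_code_vimage
      self_identifying_code_vimage self_identifying_code_dominating
    unfolding identifying_code_def[of G] locating_dominating_code_def[of G]
    by blast
qed

end
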